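(* Let $\{P_n\}_{n\ge0}$ be a sequence of matrix-valued orthogonal polynomials of size $N$ (with respect to some weight matrix $W$), and for $j=1,\dots,N$ let $\{p_{j,n}\}_{n\ge0}$ be a scalar-valued sequence of orthogonal polynomials (with respect to some scalar weight $w_j$). Then $\{P_n\}$ is a Darboux transformation of $\{p_{1,n}\oplus\cdots\oplus p_{N,n}\}$ if and only if for each $j=1,\dots,N$ there exists an $N\times1$ vector-valued linear differential operator $D_j$ such that $$P_n\cdot D_j=\Lambda_n(D_j)\,p_{j,n}\quad\text{for all } n\ge0,$$ for some $N\times 1$ vectors $\Lambda_n(D_j)\in\mathbb{C}^{N\times1}$, and the vectors $\{\Lambda_n(D_1),\dots,\Lambda_n(D_N)\}$ are linearly independent for some $n$.
   Context: Fix a possibly infinite interval $(x_0,x_1)$ of the real line. A weight matrix of size $N$ is a complex $N\times N$ matrix-valued smooth function $W$ on $(x_0,x_1)$ that is positive definite almost everywhere and has finite moments of all orders; a scalar weight is a weight matrix of size $1$. For $P,Q\in\operatorname{Mat}_N(\mathbb{C}[x])$ put $\langle P,Q\rangle_W=\int_{x_0}^{x_1}P(x)W(x)Q(x)^*\,dx$, where $*$ is the Hermitian conjugate. A sequence of matrix-valued orthogonal polynomials with respect to $W$ is a sequence $\{P_n\}_{n\in\mathbb{N}_0}$ in $\operatorname{Mat}_N(\mathbb{C}[x])$, $\mathbb{N}_0=\{0,1,\dots\}$, with $P_n$ of degree $n$ with nonsingular leading coefficient and $\langle P_n,P_m\rangle_W=0$ for $n\ne m$. The direct sum $F_1\oplus\cdots\oplus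 F_r$ is the block diagonal matrix with blocks $F_1,\dots,F_r$. Differential operators $D=\sum_{i=0}^s\partial^iF_i(x)$, $\partial=\frac{d}{dx}$, act on the right: $(P\cdot D)(x)=\sum_{i=0}^s\frac{d^iP}{dx^i}(x)F_i(x)$, and $P\cdot(DE)=(P\cdot D)\cdot E$. All differential operators (square or rectangular) have coefficients $F_i$ with entries in $\mathbb{C}[x]$. $\operatorname{Mat}_N(\Omega[x])$ is the algebra of $N\times N$ such operators. $\mathcal{D}(W)$ is the set of $D\in\operatorname{Mat}_N(\Omega[x])$ such that, for every $n\in\mathbb{N}_0$, $P_n\cdot D=\Lambda_n(D)P_n$ for some $\Lambda_n(D)\in\operatorname{Mat}_N(\mathbb{C})$ (this does not depend on the chosen orthogonal sequence $\{P_n\}$ for $W$). An operator $E\in\operatorname{Mat}_N(\Omega[x])$ is degree-preserving if, for all but finitely many $n\in\mathbb{N}_0$, for any (matrix) polynomial $f$ of degree $n$ the function $f\cdot E$ is again a polynomial of degree $n$. For sequences $\{P_n\},\{\tilde P_n\}$ of $N\times N$ matrix-valued orthogonal polynomials with respect to $W,\tilde W$, $\{\tilde P_n\}$ is a Darboux transformation of $\{P_n\}$ if there is $D\in\mathcal{D}(W)$ that can be factorized as $D=\mathcal{V}\mathcal{N}$ with degree-preserving $\mathcal{V},\mathcal{N}\in\operatorname{Mat}_N(\Omega[x])$ such that $P_n\cdot\mathcal{V}=A_n\tilde P_n$ for all $n\in\mathbb{N}_0$, for some $A_n\in\operatorname{Mat}_N(\mathbb{C})$. For $D=\sum_j\partial^jF_j$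 let $D^*=\sum_jF_j(x)^*(-1)^j\partial^j$ be the formal adjoint; thus $Q\cdot(WD^*W^{-1})=\sum_j(-1)^j\frac{d^j}{dx^j}(QWF_j^* )W^{-1}$. Standing assumption on weights: all weight matrices considered (including direct sums of the weights considered) are "good enough" in the following sense, written for a weight $W$ of size $N$: if $D\in\operatorname{Mat}_N(\Omega[x])$ and $A\in\operatorname{Mat}_N(\mathbb{C}[x])$ satisfy $\int_{x_0}^{x_1}PAW\,dx=\int_{x_0}^{x_1}P\,(W\cdot D)\,dx$ for all $P\in\operatorname{Mat}_N(\mathbb{C}[x])$, then $AW=W\cdot D$. In particular, whenever $D,\tilde D\in\operatorname{Mat}_N(\Omega[x])$ satisfy $\langle P\cdot D,Q\rangle_W=\langle P,Q\cdot\tilde D\rangle_W$ for all $P,Q\in\operatorname{Mat}_N(\mathbb{C}[x])$, one has $\tilde D=WD^*W^{-1}$. *)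

theory Defs
  imports "HOL-Analysis.Analysis"
begin

section \<open>Matrix polynomials\<close>

text \<open>
  An \<open>m \<times> n\<close> matrix polynomial has type \<open>complex poly^'n^'m\<close>: rows are indexed by \<open>'m\<close>,
  columns by \<open>'n\<close>. A scalar \<open>p\<close> is identified with the \<open>1 \<times> 1\<close> matrix \<open>mat p\<close>.
\<close>

definition mat_coeff :: "complex poly^'n^'m \<Rightarrow> nat \<Rightarrow> complex^'n^'m" where
  "mat_coeff P k = map_matrix (\<lambda>p. coeff p k) P"

definition has_degree :: "complex poly^'n^'m \<Rightarrow> nat \<Rightarrow> bool" where
  "has_degree P n \<longleftrightarrow> mat_coeff P n \<noteq> 0 \<and> (\<forall>k>n. mat_coeff P k = 0)"

definition mat_eval :: "complex poly^'n^'m \<Rightarrow> real \<Rightarrow> complex^'n^'m" where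
  "mat_eval P x = map_matrix (\<lambda>p. poly p (complex_of_real x)) P"

definition const_mat :: "complex^'n^'m \<Rightarrow> complex poly^'n^'m" where
  "const_mat A = map_matrix (\<lambda>c. [:c:]) A"

definition adj :: "complex^'n^'m \<Rightarrow> complex^'m^'n" where
  "adj A = transpose (map_matrix cnj A)"

text \<open>Direct sums: of a family of scalars, and of two square matrices.\<close>

definition diag_sum :: "('n \<Rightarrow> 'a::zero) \<Rightarrow> 'a^'n^'n" where
  "diag_sum f = (\<chi> i j. if i = j then f i else 0)"

definition direct_sum :: "'a::zero^'n^'n \<Rightarrow> 'a^'m^'m \<Rightarrow> 'a^('n + 'm)^('n + 'm)" where
  "direct_sum A B = (\<chi> i j. case (i, j) of
       (Inl k, Inl l) \<Rightarrow> A $ k $ l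
     | (Inr k, Inr l) \<Rightarrow> B $ k $ l
     | _ \<Rightarrow> 0)"

section \<open>Differential operators with polynomial coefficients, acting on the right\<close>

text \<open>
  The operator \<open>\<Sum>i. \<partial>\<^sup>i F\<^sub>i\<close> is stored as the finitely supported sequence of its coefficients
  \<open>F\<^sub>i\<close>, that is, as a polynomial in \<open>\<partial>\<close> with \<open>coeff D i = F\<^sub>i\<close>. Only the additive structure of
  the type \<open>_ poly\<close> is used; composition is \<open>dop_mult\<close>, not the product of \<open>_ poly\<close>.
\<close>

type_synonym ('m, 'n) dop = "((complex poly, 'n) vec, 'm) vec poly"

definition act :: "complex poly^'m^'l \<Rightarrow> ('m::finite, 'n::finite) dop \<Rightarrow> complex poly^'n^'l" where
  "act P D = (\<Sum>i\<le>degree D. map_matrix (pderiv ^^ i) P ** coeff D i)"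

text \<open>
  Composition. By the Leibniz rule,
  \<open>\<partial>\<^sup>i F \<partial>\<^sup>j G = \<Sum>k\<le>j. (j choose k) \<partial>\<^sup>(\<^sup>i\<^sup>+\<^sup>k\<^sup>) F\<^sup>(\<^sup>j\<^sup>-\<^sup>k\<^sup>) G\<close>
  for operators acting on the right. The lemma \<open>act_dop_mult\<close> below states \<open>P \<cdot> (D E) = (P \<cdot> D) \<cdot> E\<close>.
\<close>

definition dop_mult ::
    "('l::finite, 'm::finite) dop \<Rightarrow> ('m, 'n::finite) dop \<Rightarrow> ('l, 'n) dop" where
  "dop_mult D E = (\<Sum>i\<le>degree D. \<Sum>j\<le>degree E. \<Sum>k\<le>j.
     monom (map_matrix (\<lambda>q. of_nat (j choose k) * (pderiv ^^ (j - k)) q) (coeff D i) ** coeff E j)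
       (i + k))"

definition degree_preserving :: "('n::finite, 'n) dop \<Rightarrow> bool" where
  "degree_preserving E \<longleftrightarrow>
     (\<forall>\<^sub>F n in sequentially. \<forall>f :: complex poly^'n^'n. has_degree f n \<longrightarrow> has_degree (act f E) n)"

section \<open>Weight matrices\<close>

definition pos_def :: "complex^'n^'n \<Rightarrow> bool" where
  "pos_def A \<longleftrightarrow> adj A = A \<and>
     (\<forall>v. v \<noteq> 0 \<longrightarrow> 0 < Re (\<Sum>i\<in>UNIV. \<Sum>j\<in>UNIV. cnj (v $ i) * A $ i $ j * v $ j))"

definition nth_deriv :: "nat \<Rightarrow> (real \<Rightarrow> 'a::real_normed_vector) \<Rightarrow> real \<Rightarrow> 'a" where
  "nth_deriv k f = ((\<lambda>g x. vector_derivative g (at x)) ^^ k) f"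

definition smooth_on_einterval :: "ereal \<Rightarrow> ereal \<Rightarrow> (real \<Rightarrow> 'a::real_normed_vector) \<Rightarrow> bool" where
  "smooth_on_einterval x0 x1 f \<longleftrightarrow>
     (\<forall>k. \<forall>x\<in>einterval x0 x1. nth_deriv k f differentiable (at x))"

definition weight_matrix :: "ereal \<Rightarrow> ereal \<Rightarrow> (real \<Rightarrow> complex^'n^'n) \<Rightarrow> bool" where
  "weight_matrix x0 x1 W \<longleftrightarrow>
     smooth_on_einterval x0 x1 W \<and>
     (AE x in lborel. x \<in> einterval x0 x1 \<longrightarrow> pos_def (W x)) \<and>
     (\<forall>k. set_integrable lborel (einterval x0 x1) (\<lambda>x. x ^ k *\<^sub>R W x))"

text \<open>The function \<open>W \<cdot> D\<close>.\<close>

definition act_fun ::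
    "(real \<Rightarrow> complex^'m^'l) \<Rightarrow> ('m::finite, 'n::finite) dop \<Rightarrow> real \<Rightarrow> complex^'n^'l" where
  "act_fun W D x = (\<Sum>i\<le>degree D. nth_deriv i W x ** mat_eval (coeff D i) x)"

text \<open>
  The integrability clause says that the integrals \<open>\<integral>P (W \<cdot> D)\<close> make sense (the Bochner integral of a
  non-integrable function is \<open>0\<close>); the integrals \<open>\<integral>P A W\<close> exist since \<open>W\<close> has finite moments.
\<close>

definition good_enough :: "ereal \<Rightarrow> ereal \<Rightarrow> (real \<Rightarrow> complex^'n^'n) \<Rightarrow> bool" where
  "good_enough x0 x1 W \<longleftrightarrow>
     (\<forall>(D :: ('n, 'n) dop) (A :: complex poly^'n^'n).
        (\<forall>P :: complex poly^'n^'n.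
           set_integrable lborel (einterval x0 x1) (\<lambda>x. mat_eval P x ** act_fun W D x) \<and>
           set_lebesgue_integral lborel (einterval x0 x1)
             (\<lambda>x. mat_eval P x ** mat_eval A x ** W x) =
           set_lebesgue_integral lborel (einterval x0 x1)
             (\<lambda>x. mat_eval P x ** act_fun W D x)) \<longrightarrow>
        (\<forall>x\<in>einterval x0 x1. mat_eval A x ** W x = act_fun W D x))"

section \<open>Orthogonal polynomials, the algebra of a weight, Darboux transformations\<close>

definition inner_W ::
    "ereal \<Rightarrow> ereal \<Rightarrow> (real \<Rightarrow> complex^'n^'n) \<Rightarrow> complex poly^'n^'n \<Rightarrow> complex poly^'n^'n \<Rightarrow> complex^'n^'n"
  where
  "inner_W x0 x1 W P Q =
     set_lebesgue_integral lborel (einterval x0 x1) (\<lambda>x. mat_eval P x ** W x ** adj (mat_eval Q x))"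

definition orthogonal_polys ::
    "ereal \<Rightarrow> ereal \<Rightarrow> (real \<Rightarrow> complex^'n^'n) \<Rightarrow> (nat \<Rightarrow> complex poly^'n^'n) \<Rightarrow> bool" where
  "orthogonal_polys x0 x1 W P \<longleftrightarrow>
     (\<forall>n. has_degree (P n) n \<and> invertible (mat_coeff (P n) n)) \<and>
     (\<forall>n m. n \<noteq> m \<longrightarrow> inner_W x0 x1 W (P n) (P m) = 0)"

text \<open>The algebra \<open>\<D>(W)\<close>; the choice of the orthogonal sequence \<open>P\<close> for \<open>W\<close> is immaterial.\<close>

definition D_alg :: "ereal \<Rightarrow> ereal \<Rightarrow> (real \<Rightarrow> complex^'n^'n) \<Rightarrow> ('n::finite, 'n) dop set" where
  "D_alg x0 x1 W = {D. \<exists>P. orthogonal_polys x0 x1 W P \<and>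
     (\<forall>n. \<exists>\<Lambda> :: complex^'n^'n. act (P n) D = const_mat \<Lambda> ** P n)}"

text \<open>
  \<open>darboux_transformation x0 x1 W P Q\<close>: the sequence \<open>Q\<close> is a Darboux transformation of the sequence
  \<open>P\<close>, where \<open>P\<close> is orthogonal with respect to \<open>W\<close>.
\<close>

definition darboux_transformation ::
    "ereal \<Rightarrow> ereal \<Rightarrow> (real \<Rightarrow> complex^'n^'n) \<Rightarrow> (nat \<Rightarrow> complex poly^'n^'n) \<Rightarrow>
      (nat \<Rightarrow> complex poly^'n^'n) \<Rightarrow> bool" where
  "darboux_transformation x0 x1 W P Q \<longleftrightarrow>
     (\<exists>D \<in> D_alg x0 x1 W. \<exists>V N :: ('n, 'n) dop.
        D = dop_mult V N \<and> degree_preserving V \<and> degree_preserving N \<and>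
        (\<forall>n. \<exists>A :: complex^'n^'n. act (P n) V = const_mat A ** Q n))"

section \<open>Composition of operators and their action\<close>

lemma act_bound:
  assumes "degree D \<le> n"
  shows "act P D = (\<Sum>i\<le>n. map_matrix (pderiv ^^ i) P ** coeff D i)"
  unfolding act_def using assms
  by (intro sum.mono_neutral_left) (auto simp: coeff_eq_0)

lemma act_zero: "act P 0 = 0"
  by (simp add: act_def)

lemma act_add: "act P (D + E) = act P D + act P E"
proof -
  let ?n = "max (degree D) (degree E)"
  have "degree (D + E) \<le> ?n" by (rule degree_add_le_max)
  then show ?thesis
    by (simp add: act_bound[of _ ?n] matrix_add_ldistrib sum.distrib)
qed

lemma act_sum: "act P (sum f S) = (\<Sum>s\<in>S. act P (f s))"
  by (induction S rule: infinite_finite_induct) (simp_all add: act_zero act_add)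

lemma act_monom: "act P (monom F i) = map_matrix (pderiv ^^ i) P ** F"
proof -
  have "act P (monom F i) = (\<Sum>l\<le>i. map_matrix (pderiv ^^ l) P ** coeff (monom F i) l)"
    by (rule act_bound) (rule degree_monom_le)
  also have "\<dots> = (\<Sum>l\<in>{i}. map_matrix (pderiv ^^ l) P ** coeff (monom F i) l)"
    by (intro sum.mono_neutral_right) (auto simp: coeff_monom)
  finally show ?thesis by simp
qed

lemma higher_pderiv_mult:
  fixes p q :: "complex poly"
  shows "(pderiv ^^ j) (p * q) =
    (\<Sum>k\<le>j. of_nat (j choose k) * (pderiv ^^ k) p * (pderiv ^^ (j - k)) q)"
proof (induction j)
  case (Suc j)
  let ?t = "\<lambda>a b. (pderiv ^^ a) p * (pderiv ^^ b) q"
  have pd: "pderiv (of_nat c * r) = of_nat c * pderiv r" for c and r :: "complex poly"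
    by (simp add: of_nat_poly pderiv_smult)
  have ps: "pderiv (sum f S) = (\<Sum>s\<in>S. pderiv (f s))" for f :: "nat \<Rightarrow> complex poly" and S
    using higher_pderiv_sum[of 1 f S] by simp
  have "(pderiv ^^ Suc j) (p * q) = (\<Sum>k\<le>j. of_nat (j choose k) * (?t (Suc k) (j - k) + ?t k (Suc j - k)))"
    by (simp add: Suc ps pd mult.assoc pderiv_mult Suc_diff_le algebra_simps)
  also have "\<dots> = (\<Sum>k\<le>j. of_nat (j choose k) * ?t (Suc k) (j - k)) +
      (\<Sum>k\<le>j. of_nat (j choose k) * ?t k (Suc j - k))"
    by (simp add: sum.distrib distrib_left)
  also have "(\<Sum>k\<le>j. of_nat (j choose k) * ?t k (Suc j - k)) =
      (\<Sum>k\<le>Suc j. of_nat (j choose k) * ?t k (Suc j - k))"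
    by simp
  also have "\<dots> = ?t 0 (Suc j) + (\<Sum>k\<le>j. of_nat (j choose Suc k) * ?t (Suc k) (j - k))"
    by (subst sum.atMost_Suc_shift) simp
  also have "(\<Sum>k\<le>j. of_nat (j choose k) * ?t (Suc k) (j - k)) +
      (?t 0 (Suc j) + (\<Sum>k\<le>j. of_nat (j choose Suc k) * ?t (Suc k) (j - k))) =
      (\<Sum>k\<le>Suc j. of_nat (Suc j choose k) * ?t k (Suc j - k))"
    by (subst sum.atMost_Suc_shift) (simp add: sum.distrib algebra_simps del: funpow.simps)
  finally show ?case by (simp only: mult.assoc)
qed simp

lemma higher_pderiv_matrix_mult:
  "map_matrix (pderiv ^^ j) (A ** B) =
    (\<Sum>k\<le>j. map_matrix (pderiv ^^ k) A **
      map_matrix (\<lambda>q. of_nat (j choose k) * (pderiv ^^ (j - k)) q) B)"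
  for A :: "complex poly^'m^'l" and B :: "complex poly^'n^'m"
proof -
  have "(\<Sum>l\<in>UNIV. \<Sum>k\<le>j. of_nat (j choose k) * (pderiv ^^ k) (A $ a $ l) * (pderiv ^^ (j - k)) (B $ l $ b))
      = (\<Sum>k\<le>j. \<Sum>l\<in>UNIV. (pderiv ^^ k) (A $ a $ l) * (of_nat (j choose k) * (pderiv ^^ (j - k)) (B $ l $ b)))"
    for a b
    by (subst sum.swap) (simp add: mult_ac)
  then show ?thesis
    by (simp add: vec_eq_iff matrix_matrix_mult_def higher_pderiv_sum higher_pderiv_mult)
qed

lemma map_matrix_higher_pderiv_sum:
  "map_matrix (pderiv ^^ j) (sum f S) = (\<Sum>s\<in>S. map_matrix (pderiv ^^ j) (f s))"
  for f :: "_ \<Rightarrow> complex poly^'n^'m"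
  by (simp add: vec_eq_iff higher_pderiv_sum)

lemma matrix_mult_sum_left: "sum f S ** B = (\<Sum>s\<in>S. f s ** B)"
  for B :: "complex poly^'n^'m"
  by (simp add: vec_eq_iff matrix_matrix_mult_def sum_distrib_right sum.swap[of _ S])

theorem act_dop_mult: "act P (dop_mult D E) = act (act P D) E"
proof -
  have "act (act P D) E = (\<Sum>j\<le>degree E. \<Sum>i\<le>degree D. \<Sum>k\<le>j.
      map_matrix (pderiv ^^ k) (map_matrix (pderiv ^^ i) P) **
        map_matrix (\<lambda>q. of_nat (j choose k) * (pderiv ^^ (j - k)) q) (coeff D i) ** coeff E j)"
    by (simp add: act_def map_matrix_higher_pderiv_sum higher_pderiv_matrix_mult matrix_mult_sum_left)
  also have "\<dots> = (\<Sum>i\<le>degree D. \<Sum>j\<le>degree E. \<Sum>k\<le>j.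
      map_matrix (pderiv ^^ (i + k)) P **
        (map_matrix (\<lambda>q. of_nat (j choose k) * (pderiv ^^ (j - k)) q) (coeff D i) ** coeff E j))"
  proof -
    have "map_matrix (pderiv ^^ k) (map_matrix (pderiv ^^ i) P) = map_matrix (pderiv ^^ (i + k)) P" for i k
      by (simp add: vec_eq_iff add.commute[of i k] funpow_add)
    then show ?thesis
      by (subst sum.swap) (simp add: matrix_mul_assoc)
  qed
  also have "\<dots> = act P (dop_mult D E)"
    by (simp add: dop_mult_def act_sum act_monom)
  finally show ?thesis by simp
qed

end

theory Submission
  imports Defs
begin

text \<open>
  The key is a formal adjoint. If \<open>Q\<^sub>n \<cdot> V = A\<^sub>n P\<^sub>n\<close> for all \<open>n\<close>, then on matrix polynomials \<open>V\<close> has an adjoint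
  \<open>T\<close> between the two inner products, and \<open>P\<^sub>n \<cdot> T = B\<^sub>n Q\<^sub>n\<close> with \<open>B\<^sub>n\<close> invertible whenever \<open>A\<^sub>n\<close> is. A linear
  operator is a differential operator with polynomial coefficients iff some iterated commutator with
  multiplication by \<open>x\<close> vanishes; since \<open>x\<close> is symmetric for both inner products, this passes from \<open>V\<close> to \<open>T\<close>.

  For a Darboux transformation, \<open>A\<^sub>n\<close> is invertible for large \<open>n\<close>, and the columns of the adjoint of \<open>V\<close> are the
  required \<open>D\<^sub>j\<close>. Conversely, the \<open>D\<^sub>j\<close> are the columns of an operator \<open>N\<close> with
  \<open>P\<^sub>n \<cdot> N = \<Lambda>\<^sub>n (p\<^sub>1\<^sub>,\<^sub>n \<oplus> \<dots>)\<close>, and one factorizes through the adjoint \<open>V\<close> of \<open>N\<close>. Up to invertible leading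
  coefficients \<open>\<Lambda>\<^sub>n\<close> is polynomial in \<open>n\<close>, so its invertibility for one \<open>n\<close> gives it for all large \<open>n\<close>, which makes
  \<open>N\<close> and \<open>V\<close> degree-preserving.
\<close>

section \<open>Matrix polynomials\<close>

lemma map_matrix_nth [simp]: "map_matrix f A $ i $ j = f (A $ i $ j)"
  by (simp add: map_matrix_def)

lemma mat_coeff_nth [simp]: "mat_coeff P k $ i $ j = coeff (P $ i $ j) k"
  by (simp add: mat_coeff_def)

lemma mat_eval_nth [simp]: "mat_eval P x $ i $ j = poly (P $ i $ j) (complex_of_real x)"
  by (simp add: mat_eval_def)

lemma const_mat_nth [simp]: "const_mat A $ i $ j = [:A $ i $ j:]"
  by (simp add: const_mat_def)

lemma adj_nth [simp]: "adj A $ i $ j = cnj (A $ j $ i)"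
  by (simp add: adj_def transpose_def)

lemma diag_sum_nth [simp]: "diag_sum f $ i $ j = (if i = j then f i else 0)"
  by (simp add: diag_sum_def)

lemma mult_nth: "(A ** B) $ i $ j = (\<Sum>k\<in>UNIV. A $ i $ k * B $ k $ j)"
  by (simp add: matrix_matrix_mult_def)

lemma matrix_add_rdistrib: "(A + B) ** C = A ** C + B ** C"
  by (simp add: vec_eq_iff mult_nth distrib_right sum.distrib)

lemma matrix_diff_ldistrib: "A ** (B - C) = A ** B - A ** C" for B :: "'a::ring_1^'n^'m"
  by (simp add: vec_eq_iff mult_nth right_diff_distrib sum_subtractf)

lemma matrix_mult_zero_left: "0 ** A = 0"
  by (simp add: vec_eq_iff mult_nth)

definition x_times :: "complex poly^'n^'m \<Rightarrow> complex poly^'n^'m" where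
  "x_times = map_matrix ((*) [:0, 1:])"

lemma x_times_nth [simp]: "x_times f $ i $ j = [:0, 1:] * f $ i $ j"
  by (simp add: x_times_def)

lemma const_mat_mult: "const_mat (A ** B) = const_mat A ** const_mat B"
  by (simp add: vec_eq_iff mult_nth mult.commute flip: sum_to_poly)

lemma mat_coeff_const_mult: "mat_coeff (const_mat C ** f) k = C ** mat_coeff f k"
  by (simp add: vec_eq_iff mult_nth coeff_sum)

lemma mat_coeff_add: "mat_coeff (f + g) k = mat_coeff f k + mat_coeff g k"
  by (simp add: vec_eq_iff)

lemma mat_coeff_diff: "mat_coeff (f - g) k = mat_coeff f k - mat_coeff g k"
  by (simp add: vec_eq_iff)

lemma mat_coeff_zero [simp]: "mat_coeff 0 k = 0"
  by (simp add: vec_eq_iff)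

lemma x_times_add: "x_times (f + g) = x_times f + x_times g"
  by (simp add: vec_eq_iff algebra_simps)

lemma x_times_diff: "x_times (f - g) = x_times f - x_times g"
  by (simp add: vec_eq_iff algebra_simps)

lemma x_times_mult_left: "x_times (f ** g) = x_times f ** g"
  by (simp add: vec_eq_iff mult_nth sum_distrib_left mult.assoc del: mult_pCons_left)

lemma x_times_mult_right: "x_times (f ** g) = f ** x_times g"
  by (simp add: vec_eq_iff mult_nth sum_distrib_left mult.left_commute del: mult_pCons_left mult_pCons_right)

lemma act_add_left: "act (f + g) D = act f D + act g D"
proof -
  have "map_matrix (pderiv ^^ i) (f + g) = map_matrix (pderiv ^^ i) f + map_matrix (pderiv ^^ i) g" for i
    by (simp add: vec_eq_iff higher_pderiv_add)
  then show ?thesis by (simp add: act_def matrix_add_rdistrib sum.distrib)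
qed

lemma matrix_mult_sum_right: "A ** sum f S = (\<Sum>s\<in>S. A ** f s)"
  for A :: "complex poly^'n^'m"
  by (simp add: vec_eq_iff mult_nth sum_distrib_left sum.swap[of _ S])

lemma act_const_mult: "act (const_mat C ** f) D = const_mat C ** act f D"
proof -
  have "map_matrix (pderiv ^^ i) (const_mat C ** f) = const_mat C ** map_matrix (pderiv ^^ i) f" for i
    by (simp add: vec_eq_iff mult_nth higher_pderiv_sum higher_pderiv_smult)
  then show ?thesis by (simp add: act_def matrix_mult_sum_right matrix_mul_assoc)
qed

text \<open>Independence of the set \<open>range v\<close> does not see repeated vectors; adding
  \<open>inj v\<close> turns it into independence of the family, that is, of the columns of the
  matrix.\<close>

lemma independent_iff_invertible:
  fixes v :: "'n \<Rightarrow> 'a::field^'n"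
  shows "inj v \<and> vec.independent (range v) \<longleftrightarrow> invertible (\<chi> a j. v j $ a)"
proof -
  have col: "column i (\<chi> a j. v j $ a) = v i" for i
    by (simp add: vec_eq_iff column_def)
  have inv: "invertible (\<chi> a j. v j $ a) \<longleftrightarrow> (\<forall>c. (\<Sum>i\<in>UNIV. c i *s v i) = 0 \<longrightarrow> (\<forall>i. c i = 0))"
    by (simp add: invertible_left_inverse matrix_left_invertible_independent_columns col)
  show ?thesis unfolding inv
  proof (intro iffI conjI allI impI)
    fix c i assume "inj v \<and> vec.independent (range v)" and c: "(\<Sum>i\<in>UNIV. c i *s v i) = 0"
    then have v: "inj v" "vec.independent (range v)" by auto
    have "(\<Sum>u\<in>range v. c (inv v u) *s u) = 0"
      using c v(1) by (simp add: sum.reindex)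
    then have "c (inv v (v i)) = 0"
      by (intro vec.independentD[OF v(2) _ subset_refl]) auto
    then show "c i = 0" using v(1) by simp
  next
    assume H: "\<forall>c. (\<Sum>i\<in>UNIV. c i *s v i) = 0 \<longrightarrow> (\<forall>i. c i = 0)"
    show inj: "inj v"
    proof (rule injI, rule ccontr)
      fix i j assume ij: "v i = v j" "i \<noteq> j"
      \<comment> \<open>Two equal vectors at different indices have difference zero, a nontrivial
        relation in the family.\<close>
      let ?c = "\<lambda>k. if k = i then 1 else if k = j then - 1 else (0 :: 'a)"
      have "(\<Sum>k\<in>UNIV. ?c k *s v k) = (\<Sum>k\<in>{i, j}. ?c k *s v k)"
        by (intro sum.mono_neutral_right) auto
      also have "\<dots> = 0" using ij by (simp add: vec_eq_iff)
      finally have "?c i = 0" using H[rule_format, of ?c i] by blast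
      then show False by simp
    qed
    show "vec.independent (range v)"
    proof (rule vec.independent_if_scalars_zero)
      fix c u assume "(\<Sum>x\<in>range v. c x *s x) = 0" "u \<in> range v"
      then show "c u = 0" using H[rule_format, of "\<lambda>i. c (v i)"] inj by (auto simp: sum.reindex)
    qed simp
  qed
qed

lemma matrix_inv:
  assumes "invertible A"
  shows "A ** matrix_inv A = mat 1" "matrix_inv A ** A = mat 1"
  using assms someI_ex[of "\<lambda>A'. A ** A' = mat 1 \<and> A' ** A = mat 1"]
  by (auto simp: invertible_def matrix_inv_def)

lemma act_zero_left [simp]: "act 0 D = 0"
  using act_add_left[of 0 0 D] by simp

text \<open>This is the weight-free half of \<open>orthogonal_polys\<close>, so it also applies to
  the plain powers of x.\<close>

definition lead_invertible :: "(nat \<Rightarrow> complex poly^'n^'n) \<Rightarrow> bool" where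
  "lead_invertible P \<longleftrightarrow> (\<forall>n. has_degree (P n) n \<and> invertible (mat_coeff (P n) n))"

text \<open>One step of division: the constant left factor is chosen so that its product with
  \<open>P n\<close> cancels the coefficient of \<open>f\<close> in degree \<open>n\<close>.\<close>

lemma lead_split:
  fixes P :: "nat \<Rightarrow> complex poly^'n^'n" and f :: "complex poly^'n^'l"
  assumes "lead_invertible P" "\<forall>k>n. mat_coeff f k = 0"
  obtains g where "f = const_mat (mat_coeff f n ** matrix_inv (mat_coeff (P n) n)) ** P n + g"
    "\<forall>k\<ge>n. mat_coeff g k = 0"
proof -
  let ?C = "mat_coeff f n ** matrix_inv (mat_coeff (P n) n)"
  have inv: "matrix_inv (mat_coeff (P n) n) ** mat_coeff (P n) n = mat 1"
    and P0: "k > n \<Longrightarrow> mat_coeff (P n) k = 0" for k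
    using assms(1) by (auto simp: lead_invertible_def has_degree_def matrix_inv)
  have "mat_coeff (f - const_mat ?C ** P n) k = 0" if "k \<ge> n" for k
  proof (cases "k = n")
    case True
    then show ?thesis
      by (simp add: mat_coeff_diff mat_coeff_const_mult inv flip: matrix_mul_assoc)
  next
    case False
    then show ?thesis using that assms(2) P0
      by (simp add: mat_coeff_diff mat_coeff_const_mult)
  qed
  then show ?thesis by (intro that[of "f - const_mat ?C ** P n"]) auto
qed

text \<open>Iterating \<open>lead_split\<close> expands \<open>f\<close> in \<open>P 0\<close>, ...,
  \<open>P (n - 1)\<close> with constant left coefficients. Stated as an induction rule, it avoids
  handling the expansion explicitly.\<close>

lemma lead_span_induct:
  fixes P :: "nat \<Rightarrow> complex poly^'n^'n" and f :: "complex poly^'n^'l"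
  assumes P: "lead_invertible P"
    and f: "\<forall>k\<ge>n. mat_coeff f k = 0"
    and zero: "R 0"
    and base: "\<And>C k. k < n \<Longrightarrow> R (const_mat C ** P k)"
    and add: "\<And>f g. R f \<Longrightarrow> R g \<Longrightarrow> R (f + g)"
  shows "R f"
  using f base
proof (induction n arbitrary: f)
  case 0
  then have "f = 0" by (simp add: vec_eq_iff poly_eq_iff)
  then show ?case using zero by simp
next
  case (Suc n)
  from lead_split[OF P, of n f] Suc.prems(1) obtain g where
    g: "f = const_mat (mat_coeff f n ** matrix_inv (mat_coeff (P n) n)) ** P n + g"
    "\<forall>k\<ge>n. mat_coeff g k = 0"
    by (metis Suc_le_eq)
  have "R g" by (rule Suc.IH[OF g(2)]) (simp add: Suc.prems(2))
  from add[OF Suc.prems(2)[OF lessI] this] show ?case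
    by (rule ssubst[OF g(1), of R])
qed

lemma mat_poly_bounded:
  fixes f :: "complex poly^'n^'m"
  obtains n where "\<forall>k\<ge>n. mat_coeff f k = 0"
proof -
  define n where "n = Suc (\<Sum>i\<in>UNIV. \<Sum>j\<in>UNIV. degree (f $ i $ j))"
  have "degree (f $ i $ j) < n" for i j
  proof -
    have "degree (f $ i $ j) \<le> (\<Sum>j\<in>UNIV. degree (f $ i $ j))"
      by (rule member_le_sum) auto
    also have "\<dots> \<le> (\<Sum>i\<in>UNIV. \<Sum>j\<in>UNIV. degree (f $ i $ j))"
      by (rule member_le_sum[of _ _ "\<lambda>i. \<Sum>j\<in>UNIV. degree (f $ i $ j)"]) auto
    finally show ?thesis by (simp add: n_def)
  qed
  then have "\<forall>k\<ge>n. mat_coeff f k = 0"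
    by (simp add: vec_eq_iff) (meson coeff_eq_0 less_le_trans)
  then show ?thesis by (rule that)
qed

lemma span_induct:
  fixes P :: "nat \<Rightarrow> complex poly^'n^'n" and f :: "complex poly^'n^'l"
  assumes P: "lead_invertible P"
    and base: "\<And>C k. R (const_mat C ** P k)"
    and add: "\<And>f g. R f \<Longrightarrow> R g \<Longrightarrow> R (f + g)"
  shows "R f"
proof -
  obtain n where n: "\<forall>k\<ge>n. mat_coeff f k = 0" by (rule mat_poly_bounded)
  \<comment> \<open>The case \<open>C = 0\<close> of the base supplies the premise
    \<open>R 0\<close> of \<open>lead_span_induct\<close>.\<close>
  have "const_mat 0 ** P 0 = (0 :: complex poly^'n^'l)" by (simp add: vec_eq_iff mult_nth)
  then have "R 0" using base[of 0 0] by simp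
  then show ?thesis by (rule lead_span_induct[OF P n]) (use base add in auto)
qed

definition x_power :: "nat \<Rightarrow> complex poly^'n^'n" where
  "x_power k = mat (monom 1 k)"

lemma mat_coeff_x_power: "mat_coeff (x_power n) k = (if k = n then mat 1 else 0)"
  by (simp add: vec_eq_iff x_power_def mat_def)

lemma lead_invertible_x_power: "lead_invertible (x_power :: nat \<Rightarrow> complex poly^'n^'n)"
proof -
  have "(mat 1 :: complex^'n^'n) \<noteq> 0"
    by (simp add: vec_eq_iff mat_def)
  moreover have "mat 1 ** mat 1 = (mat 1 :: complex^'n^'n)" by simp
  ultimately show ?thesis
    by (auto simp: lead_invertible_def has_degree_def invertible_def mat_coeff_x_power)
qed

lemma x_power_Suc: "x_power (Suc k) = x_times (x_power k)"
  by (simp add: vec_eq_iff x_power_def mat_def monom_Suc)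

section \<open>Differential operators as operators with nilpotent commutators\<close>

definition x_comm :: "(complex poly^'m^'l \<Rightarrow> complex poly^'n^'l) \<Rightarrow> complex poly^'m^'l \<Rightarrow> complex poly^'n^'l"
  where "x_comm T f = T (x_times f) - x_times (T f)"

text \<open>The Leibniz rule has only two terms because x has vanishing second derivative. At
  \<open>i = 0\<close> the truncated \<open>i - 1\<close> is harmless, since its factor is
  zero.\<close>

lemma higher_pderiv_x_times:
  "(pderiv ^^ i) ([:0, 1:] * q) = [:0, 1:] * (pderiv ^^ i) q + of_nat i * (pderiv ^^ (i - 1)) q"
  for q :: "complex poly"
proof (induction i)
  case (Suc i)
  have "pderiv (of_nat i * (pderiv ^^ (i - 1)) q) = of_nat i * (pderiv ^^ i) q"
    by (cases i) (simp_all add: of_nat_poly pderiv_smult)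
  with Suc show ?case
    by (simp add: pderiv_add pderiv_mult pderiv_pCons ring_distribs flip: one_pCons
        del: mult_pCons_left mult_pCons_right)
qed simp

lemma x_comm_monom:
  "x_comm (\<lambda>f. act f (monom F i)) f =
    map_matrix (\<lambda>q. of_nat i * (pderiv ^^ (i - 1)) q) f ** F"
proof -
  have "map_matrix (pderiv ^^ i) (x_times f) =
      x_times (map_matrix (pderiv ^^ i) f) + map_matrix (\<lambda>q. of_nat i * (pderiv ^^ (i - 1)) q) f"
    by (simp add: vec_eq_iff higher_pderiv_x_times del: mult_pCons_left mult_pCons_right)
  then show ?thesis
    by (simp add: x_comm_def act_monom matrix_add_rdistrib x_times_mult_left)
qed

lemma x_times_sum: "x_times (sum f S) = (\<Sum>s\<in>S. x_times (f s))"
  by (simp add: vec_eq_iff sum_distrib_left del: mult_pCons_left mult_pCons_right)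

lemma x_comm_act_sum: "x_comm (\<lambda>f. act f (sum D S)) f = (\<Sum>s\<in>S. x_comm (\<lambda>f. act f (D s)) f)"
  by (simp add: x_comm_def act_sum x_times_sum sum_subtractf)

lemma scale_matrix_mult: "map_matrix (\<lambda>q. c * g q) A ** B = map_matrix g A ** map_matrix ((*) c) B"
  for c :: "complex poly"
  by (simp add: vec_eq_iff mult_nth mult_ac)

text \<open>By \<open>x_comm_monom\<close>, the commutator with x is formal differentiation in the
  symbol d/dx, so it lowers the order bound by one.\<close>

lemma x_comm_act:
  fixes D :: "('m::finite, 'n::finite) dop"
  assumes "degree D \<le> Suc s"
  obtains D' where "degree D' \<le> s" "x_comm (\<lambda>f :: complex poly^'m^'l. act f D) = (\<lambda>f. act f D')"
proof
  define D' where "D' = (\<Sum>i\<le>s. monom (map_matrix ((*) (of_nat (Suc i))) (coeff D (Suc i))) i)"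
  show "degree D' \<le> s"
    unfolding D'_def by (intro degree_sum_le) (auto intro: order_trans[OF degree_monom_le])
  define c where "c = coeff D"
  have D: "(\<Sum>i\<le>Suc s. monom (c i) i) = D"
    unfolding c_def by (rule poly_as_sum_of_monoms'[OF assms])
  have "x_comm (\<lambda>f. act f D) f = act f D'" for f :: "complex poly^'m^'l"
  proof -
    let ?t = "\<lambda>i. map_matrix (\<lambda>q. of_nat i * (pderiv ^^ (i - 1)) q) f ** c i"
    have "x_comm (\<lambda>f. act f D) f = (\<Sum>i\<le>Suc s. ?t i)"
      using x_comm_act_sum[of "\<lambda>i. monom (c i) i" "{..Suc s}" f] unfolding D x_comm_monom .
    also have "\<dots> = ?t 0 + (\<Sum>i\<le>s. ?t (Suc i))"
      by (rule sum.atMost_Suc_shift)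
    finally have "x_comm (\<lambda>f. act f D) f = ?t 0 + (\<Sum>i\<le>s. ?t (Suc i))" .
    moreover have "?t 0 = 0" by (simp add: vec_eq_iff mult_nth)
    moreover have "?t (Suc i) = map_matrix (pderiv ^^ i) f ** map_matrix ((*) (of_nat (Suc i))) (c (Suc i))" for i
      unfolding scale_matrix_mult by simp
    ultimately show ?thesis
      by (simp only: D'_def act_sum act_monom c_def add_0_left)
  qed
  then show "x_comm (\<lambda>f :: complex poly^'m^'l. act f D) = (\<lambda>f. act f D')" by blast
qed

lemma x_comm_act_nilpotent:
  fixes D :: "('m::finite, 'n::finite) dop"
  shows "degree D \<le> s \<Longrightarrow> (x_comm ^^ Suc s) (\<lambda>f :: complex poly^'m^'l. act f D) = (\<lambda>f. 0)"
proof (induction s arbitrary: D)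
  case 0
  then have "D = monom (coeff D 0) 0"
    by (intro poly_eqI) (simp add: coeff_eq_0)
  then obtain F where F: "D = monom F 0" ..
  have "x_comm (\<lambda>f. act f D) f = 0" for f :: "complex poly^'m^'l"
    unfolding F x_comm_monom by (simp add: vec_eq_iff mult_nth)
  then show ?case by (simp add: fun_eq_iff)
next
  case (Suc s)
  obtain D' where "degree D' \<le> s" "x_comm (\<lambda>f :: complex poly^'m^'l. act f D) = (\<lambda>f. act f D')"
    using x_comm_act[OF Suc.prems] .
  then show ?case using Suc.IH[of D'] by (simp only: funpow_Suc_right[of "Suc s"] o_apply)
qed

text \<open>Formal integration in the symbol d/dx: raise each exponent by one and divide by the new
  exponent.\<close>

lemma x_comm_antiderivative:
  fixes D' :: "('m::finite, 'n::finite) dop"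
  obtains D where "x_comm (\<lambda>f :: complex poly^'m^'l. act f D) = (\<lambda>f. act f D')"
proof
  let ?D = "\<Sum>i\<le>degree D'. monom (map_matrix ((*) [:1 / of_nat (Suc i):]) (coeff D' i)) (Suc i)"
  have "x_comm (\<lambda>f. act f ?D) f = act f D'" for f :: "complex poly^'m^'l"
  proof -
    have *: "of_nat (Suc i) * ([:1 / of_nat (Suc i):] * q) = q" for i and q :: "complex poly"
      by (simp add: of_nat_poly del: of_nat_Suc)
    have "map_matrix ((*) (of_nat (Suc i))) (map_matrix ((*) [:1 / of_nat (Suc i):]) (coeff D' i)) =
        coeff D' i" for i
      by (simp only: vec_eq_iff map_matrix_nth *) simp
    then show ?thesis
      unfolding x_comm_act_sum x_comm_monom scale_matrix_mult by (simp only: act_def diff_Suc_1)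
  qed
  then show "x_comm (\<lambda>f :: complex poly^'m^'l. act f ?D) = (\<lambda>f. act f D')" by blast
qed

lemma act_monom_0: "act f (monom F 0) = f ** F"
proof -
  have "map_matrix (pderiv ^^ 0) f = f" by (simp add: vec_eq_iff)
  then show ?thesis by (simp only: act_monom)
qed

text \<open>Converse of \<open>x_comm_act_nilpotent\<close>. Differential operators act on the
  right, so the linearity required of \<open>T\<close> is over constant matrices on the
  left.\<close>

lemma differential_operator_of_nilpotent:
  fixes T :: "complex poly^'m^'m \<Rightarrow> complex poly^'n^'m"
  assumes "(x_comm ^^ s) T = (\<lambda>f. 0)"
    and "\<And>f g. T (f + g) = T f + T g"
    and "\<And>C f. T (const_mat C ** f) = const_mat C ** T f"
  obtains D where "T = (\<lambda>f. act f D)"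
  using assms
proof (induction s arbitrary: T thesis)
  case 0
  then show ?case using act_zero by (auto simp: fun_eq_iff)
next
  case (Suc s)
  have "x_comm T (f + g) = x_comm T f + x_comm T g" for f g
    by (simp add: x_comm_def x_times_add Suc.prems)
  moreover have "x_comm T (const_mat C ** f) = const_mat C ** x_comm T f" for C f
    by (simp add: x_comm_def Suc.prems x_times_mult_right matrix_diff_ldistrib)
  moreover have "(x_comm ^^ s) (x_comm T) = (\<lambda>f. 0)"
    using Suc.prems(2) by (simp add: funpow_Suc_right del: funpow.simps)
  ultimately obtain D' where D': "x_comm T = (\<lambda>f. act f D')"
    using Suc.IH[of "x_comm T"] by blast
  obtain D where D: "x_comm (\<lambda>f :: complex poly^'m^'m. act f D) = (\<lambda>f. act f D')"
    by (rule x_comm_antiderivative)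
  txt \<open>\<open>T\<close> minus an antiderivative of its commutator commutes with \<open>x\<close>, hence is multiplication by a matrix.\<close>
  define F where "F = T (mat 1) - act (mat 1) D"
  define S where "S = (\<lambda>f. T f - act f D)"
  have S_add: "S (f + g) = S f + S g" for f g
    by (simp add: S_def Suc.prems act_add_left)
  have S_const: "S (const_mat C ** f) = const_mat C ** S f" for C f
    by (simp add: S_def Suc.prems act_const_mult matrix_diff_ldistrib)
  have S_x: "S (x_times f) = x_times (S f)" for f
    using fun_cong[OF D', of f] fun_cong[OF D, of f]
    by (simp add: S_def x_comm_def x_times_diff algebra_simps)
  have S_pow: "S (x_power k) = x_power k ** F" for k
  proof (induction k)
    case 0
    then show ?case by (simp add: x_power_def S_def F_def flip: one_pCons)
  next
    case (Suc k)
    then show ?case by (simp add: x_power_Suc S_x x_times_mult_left)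
  qed
  have "S f = f ** F" for f
    by (rule span_induct[OF lead_invertible_x_power, where R = "\<lambda>f. S f = f ** F"])
       (simp_all add: S_const S_pow S_add matrix_mul_assoc matrix_add_rdistrib)
  then have "T f = act f (D + monom F 0)" for f
    unfolding act_add act_monom_0 by (metis S_def diff_add_cancel add.commute)
  then show ?case using Suc.prems(1) by blast
qed

section \<open>The inner product of a weight\<close>

lemma adj_mult: "adj (A ** B) = adj B ** adj A"
  by (simp add: vec_eq_iff mult_nth mult.commute)

lemma adj_adj [simp]: "adj (adj A) = A"
  by (simp add: vec_eq_iff)

lemma adj_add: "adj (A + B) = adj A + adj B"
  by (simp add: vec_eq_iff)

lemma invertible_adj:
  fixes A :: "complex^'n^'n"
  assumes "invertible A"
  shows "invertible (adj A)"
proof -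
  obtain B where "A ** B = mat 1" "B ** A = mat 1" using assms by (auto simp: invertible_def)
  moreover have "adj (mat 1) = (mat 1 :: complex^'n^'n)"
    by (simp add: vec_eq_iff mat_def)
  ultimately show ?thesis
    unfolding invertible_def by (intro exI[of _ "adj B"]) (metis adj_mult)
qed

lemma invertible_if_left_cancel:
  fixes A :: "'a::field^'n^'n"
  assumes "\<And>C :: 'a^'n^'n. C ** A = 0 \<Longrightarrow> C = 0"
  shows "invertible A"
proof -
  have "x = 0" if "transpose A *v x = 0" for x
  proof -
    have "(\<Sum>k\<in>UNIV. x $ k * A $ k $ j) = 0" for j
      using that by (simp add: vec_eq_iff matrix_vector_mult_def transpose_def mult.commute)
    \<comment> \<open>A kernel vector of the transpose, repeated as every row, is a square matrix
      annihilating \<open>A\<close> from the left.\<close>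
    then have "(\<chi> i. x) ** A = 0"
      by (simp add: vec_eq_iff mult_nth)
    then have "(\<chi> i. x) = (0 :: 'a^'n^'n)" by (rule assms)
    then show ?thesis by (simp add: vec_eq_iff)
  qed
  then have "invertible (transpose A)"
    by (simp add: invertible_left_inverse matrix_left_invertible_ker)
  then show ?thesis
    by (metis invertible_left_inverse invertible_right_inverse left_invertible_transpose)
qed

section \<open>Evaluation at a point and linear maps under the integral\<close>

lemma mat_eval_mult: "mat_eval (A ** B) x = mat_eval A x ** mat_eval B x"
  by (simp add: vec_eq_iff mult_nth poly_sum)

lemma mat_eval_add: "mat_eval (A + B) x = mat_eval A x + mat_eval B x"
  by (simp add: vec_eq_iff)

lemma mat_eval_const [simp]: "mat_eval (const_mat C) x = C"
  by (simp add: vec_eq_iff)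

lemma mat_eval_x_power: "mat_eval (x_power k) x = mat (complex_of_real x ^ k)"
  by (simp add: vec_eq_iff x_power_def mat_def poly_monom)

lemma scaleR_mult_left: "(r *\<^sub>R A) ** B = r *\<^sub>R (A ** B)"
  for A :: "complex^'n^'m"
  by (simp add: vec_eq_iff mult_nth scaleR_sum_right)

lemma scaleR_mult_right: "A ** (r *\<^sub>R B) = r *\<^sub>R (A ** B)"
  for A :: "complex^'n^'m"
  by (simp add: vec_eq_iff mult_nth scaleR_sum_right)

lemma adj_scaleR: "adj (r *\<^sub>R A) = r *\<^sub>R adj A"
  by (simp add: vec_eq_iff)

lemma mat_eval_x_times: "mat_eval (x_times f) x = x *\<^sub>R mat_eval f x"
  by (simp add: vec_eq_iff scaleR_conv_of_real[where 'a = complex])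

lemma mat_mult_right: "A ** mat (complex_of_real r) = r *\<^sub>R A"
  by (simp add: vec_eq_iff mult_nth mat_def scaleR_conv_of_real[where 'a = complex] if_distrib[of "\<lambda>x. _ * x"] cong: if_cong)

lemma bounded_linear_sandwich: "bounded_linear (\<lambda>X :: complex^'m^'l. A ** X ** B)"
  by (rule linear_conv_bounded_linear[THEN iffD1], rule linearI)
     (simp_all add: matrix_add_ldistrib matrix_add_rdistrib scaleR_mult_left scaleR_mult_right)

lemma set_integrable_bounded_linear:
  assumes "bounded_linear T" "set_integrable M S f"
  shows "set_integrable M S (\<lambda>x. T (f x))"
proof -
  have "integrable M (\<lambda>x. T (indicator S x *\<^sub>R f x))"
    using assms by (auto simp: set_integrable_def intro: integrable_bounded_linear)
  then show ?thesis
    by (simp add: set_integrable_def bounded_linear.linear[OF assms(1)] linear_cmul)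
qed

lemma set_integral_bounded_linear:
  fixes f :: "_ \<Rightarrow> _::euclidean_space" and T :: "_ \<Rightarrow> _::euclidean_space"
  assumes "bounded_linear T" "set_integrable M S f"
  shows "set_lebesgue_integral M S (\<lambda>x. T (f x)) = T (set_lebesgue_integral M S f)"
proof -
  have "integral\<^sup>L M (\<lambda>x. T (indicator S x *\<^sub>R f x)) = T (integral\<^sup>L M (\<lambda>x. indicator S x *\<^sub>R f x))"
    using assms by (auto simp: set_integrable_def intro: integral_bounded_linear)
  then show ?thesis
    by (simp add: set_lebesgue_integral_def bounded_linear.linear[OF assms(1)] linear_cmul)
qed

text \<open>The moments make the form on matrix polynomials finite; positivity on an interval with
  x0 < x1 makes it definite.\<close>

locale moment_weight =
  fixes x0 x1 :: ereal and W :: "real \<Rightarrow> complex^'n^'n"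
  assumes nonempty: "x0 < x1"
    and pos_def: "AE x in lborel. x \<in> einterval x0 x1 \<longrightarrow> pos_def (W x)"
    and moments: "\<And>k. set_integrable lborel (einterval x0 x1) (\<lambda>x. x ^ k *\<^sub>R W x)"
begin

text \<open>Expanding both arguments in powers of x leaves constants on both sides of a moment of
  \<open>W\<close>.\<close>

lemma integrable:
  "set_integrable lborel (einterval x0 x1) (\<lambda>x. mat_eval P x ** W x ** adj (mat_eval Q x))"
  for P Q :: "complex poly^'n^'n"
proof -
  have *: "set_integrable lborel (einterval x0 x1)
     (\<lambda>x. mat_eval (const_mat C ** x_power k) x ** W x ** adj (mat_eval (const_mat D ** x_power l) x))"
    for C D :: "complex^'n^'n" and k l
    using set_integrable_bounded_linear[OF bounded_linear_sandwich[of C "adj D"] moments[of "k + l"]]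
    by (simp add: mat_eval_mult mat_eval_x_power mat_mult_right scaleR_mult_left scaleR_mult_right
        adj_scaleR power_add mult.commute flip: of_real_power)
  show ?thesis
  proof (rule span_induct[OF lead_invertible_x_power, where f = P])
    show "set_integrable lborel (einterval x0 x1)
     (\<lambda>x. mat_eval (const_mat C ** x_power k) x ** W x ** adj (mat_eval Q x))"
      for C :: "complex^'n^'n" and k
      by (rule span_induct[OF lead_invertible_x_power, where f = Q])
         (simp_all add: * mat_eval_add adj_add matrix_add_ldistrib set_integral_add)
  qed (simp add: mat_eval_add matrix_add_rdistrib set_integral_add)
qed

abbreviation ip :: "complex poly^'n^'n \<Rightarrow> complex poly^'n^'n \<Rightarrow> complex^'n^'n"
  where "ip \<equiv> inner_W x0 x1 W"

lemma ip_add_left: "ip (f + g) h = ip f h + ip g h"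
  by (simp add: inner_W_def mat_eval_add matrix_add_rdistrib set_integral_add integrable)

lemma ip_add_right: "ip h (f + g) = ip h f + ip h g"
  by (simp add: inner_W_def mat_eval_add adj_add matrix_add_ldistrib set_integral_add integrable)

lemma ip_const_left: "ip (const_mat C ** f) h = C ** ip f h"
  using set_integral_bounded_linear[OF bounded_linear_sandwich[of C "mat 1"] integrable[of f h]]
  by (simp add: inner_W_def mat_eval_mult matrix_mul_assoc)

lemma ip_const_right: "ip h (const_mat C ** f) = ip h f ** adj C"
  using set_integral_bounded_linear[OF bounded_linear_sandwich[of "mat 1" "adj C"] integrable[of h f]]
  by (simp add: inner_W_def mat_eval_mult matrix_mul_assoc adj_mult)

lemma ip_x_times: "ip (x_times f) h = ip f (x_times h)"
  by (simp add: inner_W_def mat_eval_x_times adj_scaleR scaleR_mult_left scaleR_mult_right)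

lemma ip_zero_left [simp]: "ip 0 h = 0"
  using ip_add_left[of 0 0 h] by simp

lemma ip_zero_right [simp]: "ip h 0 = 0"
  using ip_add_right[of h 0 0] by simp

lemma ip_diff_left: "ip (f - g) h = ip f h - ip g h"
  using ip_add_left[of "f - g" g h] by (simp add: algebra_simps)

lemma ip_diff_right: "ip h (f - g) = ip h f - ip h g"
  using ip_add_right[of h "f - g" g] by (simp add: algebra_simps)

text \<open>A diagonal entry of the integrand is the quadratic form of \<open>W\<close> at a
  conjugated row of \<open>f\<close>. If its integral is zero, that row vanishes almost everywhere
  on the interval, although a nonzero polynomial has only finitely many roots.\<close>

lemma ip_definite:
  assumes "ip f f = 0"
  shows "f = 0"
proof (rule ccontr)
  let ?I = "einterval x0 x1"
  assume "f \<noteq> 0"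
  then obtain i j where ij: "f $ i $ j \<noteq> 0" by (auto simp: vec_eq_iff)
  \<comment> \<open>Conjugation makes \<open>g x\<close> the form of \<open>W x\<close> at
    \<open>v x\<close>; row \<open>i\<close> is taken because it contains a nonzero entry.\<close>
  define v where "v = (\<lambda>x. \<chi> k. cnj (mat_eval f x $ i $ k))"
  define g where "g = (\<lambda>x. Re ((mat_eval f x ** W x ** adj (mat_eval f x)) $ i $ i))"
  have g: "g x = Re (\<Sum>k\<in>UNIV. \<Sum>l\<in>UNIV. cnj (v x $ k) * W x $ k $ l * v x $ l)" for x
    unfolding g_def v_def
    by (simp only: mult_nth adj_nth sum_distrib_right vec_lambda_beta complex_cnj_cnj)
       (subst sum.swap, rule refl)
  have bl: "bounded_linear (\<lambda>X :: complex^'n^'n. Re (X $ i $ i))"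
    by (intro bounded_linear_compose[OF bounded_linear_Re] bounded_linear_compose[OF bounded_linear_vec_nth]
        bounded_linear_vec_nth)
  have int: "set_integrable lborel ?I g"
    unfolding g_def by (rule set_integrable_bounded_linear[OF bl integrable])
  have "set_lebesgue_integral lborel ?I g = 0"
    unfolding g_def using assms
    by (subst set_integral_bounded_linear[OF bl integrable]) (simp add: inner_W_def)
  moreover have "AE x in lborel. 0 \<le> indicator ?I x *\<^sub>R g x"
    using pos_def
  proof eventually_elim
    case (elim x)
    then show ?case
      by (cases "v x = 0") (auto simp: g pos_def_def indicator_def less_imp_le)
  qed
  ultimately have "AE x in lborel. indicator ?I x *\<^sub>R g x = 0"
    using integral_nonneg_eq_0_iff_AE[OF int[unfolded set_integrable_def]]
    by (simp add: set_lebesgue_integral_def)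
  with pos_def have AE: "AE x in lborel. x \<in> ?I \<longrightarrow> poly (f $ i $ j) (complex_of_real x) = 0"
  proof eventually_elim
    case (elim x)
    then have "v x = 0" if "x \<in> ?I"
      using that by (auto simp: g pos_def_def)
    then show ?case by (auto simp: v_def vec_eq_iff)
  qed
  have "finite (complex_of_real -` {z. poly (f $ i $ j) z = 0})"
    by (intro finite_vimageI poly_roots_finite ij) (simp add: inj_on_def)
  then have "complex_of_real -` {z. poly (f $ i $ j) z = 0} \<in> null_sets lborel"
    by (rule finite_imp_null_set_lborel)
  then have "AE x in lborel. x \<notin> complex_of_real -` {z. poly (f $ i $ j) z = 0}"
    by (rule AE_not_in)
  \<comment> \<open>Almost no point of the interval avoids the finite root set, so the interval
    would be null; a nonempty open set is not.\<close>
  with AE have "AE x in lborel. x \<notin> ?I" by eventually_elim auto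
  then have "?I \<in> null_sets lborel"
    by (subst (asm) AE_iff_null_sets[symmetric]) auto
  then have "negligible ?I"
    by (simp add: negligible_iff_null_sets null_sets_completionI)
  moreover have "?I \<noteq> {}"
    using nonempty using einterval_nonempty by fastforce
  ultimately show False
    using open_not_negligible open_einterval by blast
qed

text \<open>Testing with \<open>g - h\<close> reduces to definiteness. Identities for an adjoint can
  thus be checked by pairing.\<close>

lemma ip_nondegenerate: "(\<And>f. ip f g = ip f h) \<Longrightarrow> g = h"
  using ip_definite[of "g - h"] by (simp add: ip_diff_right)

text \<open>If \<open>C\<close> kills the norm of \<open>f\<close>, then \<open>C\<close> times
  \<open>f\<close> has norm zero and vanishes; comparing the invertible coefficient gives
  \<open>C = 0\<close>.\<close>

lemma invertible_ip:
  assumes "invertible (mat_coeff f n)"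
  shows "invertible (ip f f)"
proof (rule invertible_if_left_cancel)
  fix C :: "complex^'n^'n" assume "C ** ip f f = 0"
  then have "ip (const_mat C ** f) (const_mat C ** f) = 0"
    by (simp add: ip_const_left ip_const_right)
  then have "const_mat C ** f = 0" by (rule ip_definite)
  then have "C ** mat_coeff f n = 0" by (metis mat_coeff_const_mult mat_coeff_zero)
  then have "C ** (mat_coeff f n ** matrix_inv (mat_coeff f n)) = 0"
    by (simp add: matrix_mul_assoc)
  then show "C = 0" by (simp add: matrix_inv assms)
qed

end

lemma orthogonal_polys_lead: "orthogonal_polys x0 x1 W P \<Longrightarrow> lead_invertible P"
  by (simp add: orthogonal_polys_def lead_invertible_def)

section \<open>Adjoints of operators between orthogonal sequences\<close>

text \<open>Since x is symmetric for both forms, moving a commutator across the pairing reverses its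
  two terms; each application costs one sign.\<close>

lemma x_comm_adjoint:
  assumes W1: "moment_weight x0 x1 W1" and W2: "moment_weight x0 x1 W2"
    and TU: "\<And>f g. inner_W x0 x1 W1 f (T g) = inner_W x0 x1 W2 (U f) g"
  shows "inner_W x0 x1 W1 f ((x_comm ^^ s) T g) = (- 1) ^ s *\<^sub>R inner_W x0 x1 W2 ((x_comm ^^ s) U f) g"
proof (induction s arbitrary: f g)
  case 0
  then show ?case by (simp add: TU)
next
  case (Suc s)
  interpret w1: moment_weight x0 x1 W1 by fact
  interpret w2: moment_weight x0 x1 W2 by fact
  let ?S = "(x_comm ^^ s) T" and ?R = "(x_comm ^^ s) U"
  have "w1.ip f (x_comm ?S g) = w1.ip f (?S (x_times g)) - w1.ip (x_times f) (?S g)"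
    by (simp add: x_comm_def w1.ip_diff_right w1.ip_x_times)
  also have "\<dots> = (- 1) ^ s *\<^sub>R (w2.ip (x_times (?R f)) g - w2.ip (?R (x_times f)) g)"
    by (simp add: Suc w2.ip_x_times scaleR_diff_right)
  also have "\<dots> = (- 1) ^ Suc s *\<^sub>R w2.ip (x_comm ?R f) g"
    by (simp add: x_comm_def w2.ip_diff_left scaleR_diff_right)
  finally show ?case by simp
qed

lemma adjoint_operator:
  fixes V :: "('n::finite, 'n) dop"
  assumes W1: "moment_weight x0 x1 W1" and W2: "moment_weight x0 x1 W2"
    and Q: "orthogonal_polys x0 x1 W1 Q" and P: "orthogonal_polys x0 x1 W2 P"
    and V: "\<And>n. act (Q n) V = const_mat (A n) ** P n"
  obtains V' :: "('n, 'n) dop" and B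
  where "\<And>n. act (P n) V' = const_mat (B n) ** Q n" "\<And>n. invertible (A n) \<Longrightarrow> invertible (B n)"
proof -
  interpret w1: moment_weight x0 x1 W1 by fact
  interpret w2: moment_weight x0 x1 W2 by fact
  note lQ = orthogonal_polys_lead[OF Q] and lP = orthogonal_polys_lead[OF P]
  \<comment> \<open>The value is forced: pairing \<open>Q n\<close> with the image of
    \<open>P n\<close> must give \<open>A n\<close> times the norm of \<open>P n\<close>. The second
    slot is conjugate-linear, hence the \<open>adj\<close>.\<close>
  define B where "B n = adj (matrix_inv (w1.ip (Q n) (Q n)) ** A n ** w2.ip (P n) (P n))" for n
  have invQ: "invertible (w1.ip (Q n) (Q n))" and invP: "invertible (w2.ip (P n) (P n))" for n
    using lQ lP w1.invertible_ip w2.invertible_ip unfolding lead_invertible_def by blast+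
  have QP: "w1.ip f (const_mat (B n) ** Q n) = w2.ip (act f V) (P n)" for f n
  proof (rule span_induct[OF lQ, where f = f])
    fix C :: "complex^'n^'n" and k
    show "w1.ip (const_mat C ** Q k) (const_mat (B n) ** Q n) = w2.ip (act (const_mat C ** Q k) V) (P n)"
    proof (cases "k = n")
      case True
      have "w1.ip (Q n) (Q n) ** adj (B n) = A n ** w2.ip (P n) (P n)"
        by (simp add: B_def matrix_mul_assoc matrix_inv invQ)
      with True show ?thesis
        by (simp add: w1.ip_const_left w1.ip_const_right act_const_mult V w2.ip_const_left
            flip: matrix_mul_assoc)
    next
      case False
      then show ?thesis using P Q
        by (simp add: w1.ip_const_left w1.ip_const_right act_const_mult V w2.ip_const_left
            orthogonal_polys_def)
    qed
  qed (simp add: w1.ip_add_left w2.ip_add_left act_add_left)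
  \<comment> \<open>The adjoint image is known on each \<open>P k\<close> and extends to all
    polynomials by expansion; nondegeneracy then gives its linearity.\<close>
  have "\<exists>h. \<forall>f. w1.ip f h = w2.ip (act f V) g" for g
  proof (rule span_induct[OF lP, where f = g])
    fix C :: "complex^'n^'n" and k
    show "\<exists>h. \<forall>f. w1.ip f h = w2.ip (act f V) (const_mat C ** P k)"
      by (rule exI[of _ "const_mat C ** (const_mat (B k) ** Q k)"])
         (simp only: w1.ip_const_right[of _ C] w2.ip_const_right QP simp_thms)
  next
    fix g1 g2
    assume "\<exists>h. \<forall>f. w1.ip f h = w2.ip (act f V) g1" "\<exists>h. \<forall>f. w1.ip f h = w2.ip (act f V) g2"
    then show "\<exists>h. \<forall>f. w1.ip f h = w2.ip (act f V) (g1 + g2)"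
      by (metis w1.ip_add_right w2.ip_add_right)
  qed
  then obtain T where T: "\<And>f g. w1.ip f (T g) = w2.ip (act f V) g" by metis
  have T_P: "T (P n) = const_mat (B n) ** Q n" for n
    by (rule w1.ip_nondegenerate) (simp add: T QP)
  have "T (f + g) = T f + T g" for f g
    by (rule w1.ip_nondegenerate) (simp add: T w1.ip_add_right w2.ip_add_right)
  moreover have "T (const_mat C ** f) = const_mat C ** T f" for C f
    by (rule w1.ip_nondegenerate) (simp add: T w1.ip_const_right w2.ip_const_right)
  moreover have "(x_comm ^^ Suc (degree V)) T = (\<lambda>f. 0)"
  proof
    fix g
    show "(x_comm ^^ Suc (degree V)) T g = 0"
      \<comment> \<open>The iterated commutator moves to \<open>V\<close>, where one more commutator
        than the order gives zero.\<close>
      using x_comm_adjoint[OF W1 W2, of T "\<lambda>f. act f V" _ "Suc (degree V)" g] T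
      by (intro w1.ip_nondegenerate) (simp add: x_comm_act_nilpotent del: funpow.simps)
  qed
  ultimately obtain V' where V': "T = (\<lambda>f. act f V')"
    using differential_operator_of_nilpotent by blast
  have "act (P n) V' = const_mat (B n) ** Q n" for n
    using T_P V' by metis
  moreover have "invertible (B n)" if "invertible (A n)" for n
  proof -
    have "invertible (matrix_inv (w1.ip (Q n) (Q n)))"
      using matrix_inv[OF invQ] unfolding invertible_def by blast
    then show ?thesis unfolding B_def by (intro invertible_adj invertible_mult that invP)
  qed
  ultimately show ?thesis by (rule that)
qed

section \<open>Degree-preserving operators\<close>

text \<open>It covers both factors: \<open>V\<close> carries the scalar sequence to
  \<open>P\<close>, and \<open>N\<close> goes back.\<close>

locale diagonal_action =
  fixes P Q :: "nat \<Rightarrow> complex poly^'n^'n" and D :: "('n::finite, 'n) dop" and L :: "nat \<Rightarrow> complex^'n^'n"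
  assumes lead_P: "lead_invertible P" and lead_Q: "lead_invertible Q"
    and act_P: "\<And>n. act (P n) D = const_mat (L n) ** Q n"
begin

lemma act_degree_less:
  assumes "\<forall>k\<ge>n. mat_coeff f k = 0"
  shows "\<forall>k\<ge>n. mat_coeff (act f D) k = 0"
proof (rule lead_span_induct[OF lead_P assms])
  fix C :: "complex^'n^'a" and k
  assume "k < n"
  then show "\<forall>l\<ge>n. mat_coeff (act (const_mat C ** P k) D) l = 0"
    using lead_Q
    by (simp add: act_const_mult act_P mat_coeff_const_mult lead_invertible_def has_degree_def)
qed (simp_all add: act_add_left mat_coeff_add)

text \<open>Only the \<open>P n\<close> term of the expansion reaches degree \<open>n\<close>, so on
  top coefficients \<open>D\<close> is right multiplication by one matrix.\<close>

lemma act_lead_coeff: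
  assumes "\<forall>k>n. mat_coeff f k = 0"
  shows "mat_coeff (act f D) n =
    mat_coeff f n ** (matrix_inv (mat_coeff (P n) n) ** L n ** mat_coeff (Q n) n)"
proof -
  obtain g where g: "f = const_mat (mat_coeff f n ** matrix_inv (mat_coeff (P n) n)) ** P n + g"
    "\<forall>k\<ge>n. mat_coeff g k = 0"
    using lead_split[OF lead_P assms] .
  show ?thesis
    using act_degree_less[OF g(2)]
    by (subst g(1)) (simp add: act_add_left act_const_mult act_P mat_coeff_add mat_coeff_const_mult
        flip: matrix_mul_assoc)
qed

lemma invertible_act_lead:
  "invertible (matrix_inv (mat_coeff (P n) n) ** L n ** mat_coeff (Q n) n) \<longleftrightarrow> invertible (L n)"
proof -
  have "det (mat_coeff (P n) n) \<noteq> 0" "det (mat_coeff (Q n) n) \<noteq> 0"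
    using lead_P lead_Q by (auto simp: lead_invertible_def invertible_det_nz)
  moreover have "det (matrix_inv (mat_coeff (P n) n)) \<noteq> 0"
    using matrix_inv lead_P unfolding lead_invertible_def
    by (metis invertible_def invertible_det_nz)
  ultimately show ?thesis by (simp add: invertible_det_nz det_mul)
qed

lemma degree_preserving:
  assumes "\<forall>\<^sub>F n in sequentially. invertible (L n)"
  shows "degree_preserving D"
  unfolding degree_preserving_def using assms
proof eventually_elim
  case (elim n)
  show ?case
  proof (intro allI impI)
    fix f :: "complex poly^'n^'n"
    assume f: "has_degree f n"
    let ?M = "matrix_inv (mat_coeff (P n) n) ** L n ** mat_coeff (Q n) n"
    have "mat_coeff f n = mat_coeff f n ** ?M ** matrix_inv ?M"
      using elim by (simp add: invertible_act_lead matrix_inv flip: matrix_mul_assoc[of _ ?M])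
    then have "mat_coeff f n ** ?M \<noteq> 0"
      using f by (auto simp: has_degree_def matrix_mult_zero_left)
    then show "has_degree (act f D) n"
      using f act_lead_coeff[of n f] act_degree_less[of "Suc n" f]
      by (simp add: has_degree_def Suc_le_eq)
  qed
qed

text \<open>A nonzero \<open>C\<close> with \<open>C ** L n = 0\<close> would send the degree
  \<open>n\<close> polynomial \<open>const_mat C ** P n\<close> to zero.\<close>

lemma eventually_invertible_if_degree_preserving:
  assumes "degree_preserving D"
  shows "\<forall>\<^sub>F n in sequentially. invertible (L n)"
  using assms unfolding degree_preserving_def
proof eventually_elim
  case (elim n)
  show ?case
  proof (rule invertible_if_left_cancel, rule ccontr)
    fix C :: "complex^'n^'n"
    assume C: "C ** L n = 0" "C \<noteq> 0"
    have "C ** mat_coeff (P n) n \<noteq> 0"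
    proof
      assume "C ** mat_coeff (P n) n = 0"
      then have "C ** (mat_coeff (P n) n ** matrix_inv (mat_coeff (P n) n)) = 0"
        by (simp add: matrix_mul_assoc)
      then show False using C lead_P by (simp add: matrix_inv lead_invertible_def)
    qed
    then have "has_degree (const_mat C ** P n) n"
      using lead_P by (simp add: has_degree_def mat_coeff_const_mult lead_invertible_def)
    then have "has_degree (const_mat C ** (const_mat (L n) ** Q n)) n"
      using elim by (metis act_const_mult act_P)
    then have "C ** (L n ** mat_coeff (Q n) n) \<noteq> 0"
      by (simp add: has_degree_def mat_coeff_const_mult)
    then show False using C(1) by (simp add: matrix_mul_assoc)
  qed
qed

end

text \<open>Differentiating x^n exactly \<open>i\<close> times gives the falling factorial
  n(n-1)...(n-i+1) times x^(n-i), so only the coefficient of \<open>F\<close> in degree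
  \<open>i\<close> contributes. The product writes this factor as a polynomial in n.\<close>

lemma coeff_higher_pderiv_monom_mult:
  "coeff ((pderiv ^^ i) (monom 1 n) * F) n =
    poly (smult (coeff F i) (\<Prod>t<i. [:- of_nat t, 1:])) (of_nat n :: complex)"
proof -
  have pd: "(pderiv ^^ i) (monom 1 n) =
      smult (poly (\<Prod>t<i. [:- of_nat t, 1:]) (of_nat n :: complex)) (monom 1 (n - i))" for i
  proof (induction i)
    case (Suc i)
    \<comment> \<open>Truncated and true subtraction agree here: for \<open>i > n\<close> the
      product contains the zero factor \<open>t = n\<close>.\<close>
    have "of_nat (n - i) * poly (\<Prod>t<i. [:- of_nat t, 1:]) (of_nat n :: complex) =
        (of_nat n - of_nat i) * poly (\<Prod>t<i. [:- of_nat t, 1:]) (of_nat n)"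
    proof (cases "i \<le> n")
      case False
      then have "poly (\<Prod>t<i. [:- of_nat t, 1:]) (of_nat n :: complex) = 0"
        by (auto simp: poly_prod)
      then show ?thesis by simp
    qed (simp add: of_nat_diff)
    then show ?case
      by (simp add: Suc pderiv_smult pderiv_monom smult_monom algebra_simps)
  qed simp
  show ?thesis
  proof (cases "i \<le> n")
    case True
    then show ?thesis by (simp add: pd coeff_monom_mult)
  next
    case False
    then have "poly (\<Prod>t<i. [:- of_nat t, 1:]) (of_nat n :: complex) = 0"
      by (auto simp: poly_prod)
    then show ?thesis by (simp add: pd)
  qed
qed

lemma (in diagonal_action) eventually_invertible:
  assumes "invertible (L n\<^sub>0)"
  shows "\<forall>\<^sub>F n in sequentially. invertible (L n)"
proof -
  define M where "M n = mat_coeff (act (x_power n :: complex poly^'n^'n) D) n" for n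
  \<comment> \<open>These polynomials interpolate the entries of \<open>M n\<close> at every n, so
    \<open>det q\<close> governs invertibility for all n at once.\<close>
  define q where "q = (\<chi> a b. \<Sum>i\<le>degree D.
    smult (coeff (coeff D i $ a $ b) i) (\<Prod>t<i. [:- complex_of_nat t, 1:]))"
  have "M n = matrix_inv (mat_coeff (P n) n) ** L n ** mat_coeff (Q n) n" for n
    using act_lead_coeff[of n "x_power n"] by (simp add: M_def mat_coeff_x_power)
  then have L: "invertible (L n) \<longleftrightarrow> det (M n) \<noteq> 0" for n
    by (metis invertible_act_lead invertible_det_nz)
  have "M n $ a $ b = poly (q $ a $ b) (of_nat n)" for n a b
  proof -
    have "(map_matrix (pderiv ^^ i) (x_power n) ** F) $ a $ b = (pderiv ^^ i) (monom 1 n) * F $ a $ b"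
      for i and F :: "complex poly^'n^'n"
    proof -
      have "(map_matrix (pderiv ^^ i) (x_power n) ** F) $ a $ b =
          (\<Sum>k\<in>UNIV. if a = k then (pderiv ^^ i) (monom 1 n) * F $ k $ b else 0)"
        unfolding mult_nth by (rule sum.cong) (simp_all add: x_power_def mat_def)
      then show ?thesis by simp
    qed
    then show ?thesis
      by (simp add: M_def q_def act_def coeff_sum coeff_higher_pderiv_monom_mult poly_sum)
  qed
  then have det: "det (M n) = poly (det q) (of_nat n)" for n
    by (simp add: det_def poly_sum poly_prod)
  \<comment> \<open>The single index \<open>n\<^sub>0\<close> shows that \<open>det q\<close> is not
    the zero polynomial; its finitely many roots are the only exceptions.\<close>
  have "det q \<noteq> 0" using assms L det by auto
  then have "finite (of_nat -` {z. poly (det q) z = 0} :: nat set)"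
    by (intro finite_vimageI poly_roots_finite) (auto intro: injI)
  then have "\<forall>\<^sub>F n in cofinite. n \<notin> of_nat -` {z. poly (det q) z = 0}"
    by (simp add: eventually_cofinite)
  then show ?thesis
    by (simp add: L det cofinite_eq_sequentially)
qed

section \<open>Direct sums of scalar weights\<close>

lemma moment_weightI: "x0 < x1 \<Longrightarrow> weight_matrix x0 x1 W \<Longrightarrow> moment_weight x0 x1 W"
  by (simp add: weight_matrix_def moment_weight_def)

lemma mat_1_nth [simp]: "(mat c :: 'a::zero^1^1) $ i $ j = c"
  by (simp add: mat_def num1_eq1[of i] num1_eq1[of j])

lemma pos_def_mat_1: "pos_def (mat c :: complex^1^1) \<Longrightarrow> cnj c = c \<and> 0 < Re c"
  unfolding pos_def_def by (auto simp: vec_eq_iff dest!: spec[of _ "(\<chi> i. 1) :: complex^1"])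

lemma pos_def_diag_sum:
  fixes w :: "'n::finite \<Rightarrow> complex"
  assumes "\<And>j. pos_def (mat (w j) :: complex^1^1)"
  shows "pos_def (diag_sum w)"
  unfolding pos_def_def
proof (intro conjI allI impI)
  have w: "cnj (w j) = w j" "0 < Re (w j)" for j
    using pos_def_mat_1[OF assms] by auto
  then show "adj (diag_sum w) = diag_sum w"
    by (auto simp: vec_eq_iff)
  fix v :: "complex^'n" assume "v \<noteq> 0"
  then obtain k where k: "v $ k \<noteq> 0" by (auto simp: vec_eq_iff)
  have "(\<Sum>j\<in>UNIV. cnj (v $ i) * diag_sum w $ i $ j * v $ j) = cnj (v $ i) * w i * v $ i" for i
  proof -
    have "(\<Sum>j\<in>UNIV. cnj (v $ i) * diag_sum w $ i $ j * v $ j) =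
        (\<Sum>j\<in>UNIV. if i = j then cnj (v $ i) * w i * v $ i else 0)"
      by (rule sum.cong) auto
    then show ?thesis by simp
  qed
  moreover have "Re (cnj (v $ i) * w i * v $ i) = Re (w i) * (cmod (v $ i))\<^sup>2" for i
    unfolding cmod_power2 by (simp add: power2_eq_square algebra_simps)
  moreover have "0 < (\<Sum>i\<in>UNIV. Re (w i) * (cmod (v $ i))\<^sup>2)"
    using w k by (intro sum_pos2[of _ k]) (auto intro!: mult_nonneg_nonneg less_imp_le[OF w(2)])
  ultimately show "0 < Re (\<Sum>i\<in>UNIV. \<Sum>j\<in>UNIV. cnj (v $ i) * diag_sum w $ i $ j * v $ j)"
    by simp
qed

lemma moment_weight_diag_sum:
  fixes w :: "'n::finite \<Rightarrow> real \<Rightarrow> complex"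
  assumes "\<And>j. moment_weight x0 x1 (\<lambda>x. mat (w j x) :: complex^1^1)"
  shows "moment_weight x0 x1 (\<lambda>x. diag_sum (\<lambda>j. w j x))"
proof
  show "x0 < x1" using assms by (simp add: moment_weight_def)
  have "AE x in lborel. \<forall>j\<in>UNIV. x \<in> einterval x0 x1 \<longrightarrow> pos_def (mat (w j x) :: complex^1^1)"
    by (rule AE_finite_allI) (use assms in \<open>auto simp: moment_weight_def\<close>)
  then show "AE x in lborel. x \<in> einterval x0 x1 \<longrightarrow> pos_def (diag_sum (\<lambda>j. w j x))"
    by eventually_elim (auto intro: pos_def_diag_sum)
  fix k
  \<comment> \<open>Standard basis columns place each scalar weight on the diagonal, making the sum
    a combination of linear images of 1x1 matrices.\<close>
  define E :: "'n \<Rightarrow> complex^1^'n" where "E j = (\<chi> i l. if i = j then 1 else 0)" for j :: 'n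
  have "x ^ k *\<^sub>R diag_sum (\<lambda>j. w j x) =
      (\<Sum>j\<in>UNIV. E j ** (x ^ k *\<^sub>R (mat (w j x) :: complex^1^1)) ** transpose (E j))" for x
    by (simp add: vec_eq_iff mult_nth E_def transpose_def if_distrib[of "\<lambda>x. x * _"]
        if_distrib[of "\<lambda>x. _ * x"] cong: if_cong)
  moreover have "set_integrable lborel (einterval x0 x1)
      (\<lambda>x. E j ** (x ^ k *\<^sub>R (mat (w j x) :: complex^1^1)) ** transpose (E j))" for j
    using assms by (intro set_integrable_bounded_linear[OF bounded_linear_sandwich]) (simp add: moment_weight_def)
  ultimately show "set_integrable lborel (einterval x0 x1) (\<lambda>x. x ^ k *\<^sub>R diag_sum (\<lambda>j. w j x))"
    unfolding set_integrable_def by (simp only: scaleR_sum_right) (intro Bochner_Integration.integrable_sum)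
qed

lemma diag_sum_mult: "diag_sum f ** diag_sum g = diag_sum (\<lambda>i. f i * g i)"
proof -
  have "(diag_sum f ** diag_sum g) $ i $ j = (\<Sum>k\<in>UNIV. if i = k then f i * diag_sum g $ i $ j else 0)" for i j
    unfolding mult_nth by (rule sum.cong) auto
  then show ?thesis by (simp add: vec_eq_iff)
qed

lemma mat_coeff_diag_sum: "mat_coeff (diag_sum p) k = diag_sum (\<lambda>j. coeff (p j) k)"
  by (simp add: vec_eq_iff)

lemma adj_diag_sum: "adj (diag_sum f) = diag_sum (\<lambda>j. cnj (f j))"
  by (auto simp: vec_eq_iff)

lemma mat_eval_diag_sum: "mat_eval (diag_sum p) x = diag_sum (\<lambda>j. poly (p j) (complex_of_real x))"
  by (simp add: vec_eq_iff)

lemma bounded_linear_entry: "bounded_linear (\<lambda>X :: complex^'n^'m. X $ i $ j)"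
  by (intro bounded_linear_compose[OF bounded_linear_vec_nth] bounded_linear_vec_nth)

lemma (in moment_weight) ip_nth:
  "ip f g $ i $ j = set_lebesgue_integral lborel (einterval x0 x1)
    (\<lambda>x. (mat_eval f x ** W x ** adj (mat_eval g x)) $ i $ j)"
  unfolding inner_W_def
  by (rule set_integral_bounded_linear[OF bounded_linear_entry integrable, symmetric])

text \<open>The integrand is diagonal, and its diagonal entries are those of the scalar
  orthogonality relations.\<close>

lemma orthogonal_polys_diag_sum:
  fixes w :: "'n::finite \<Rightarrow> real \<Rightarrow> complex"
  assumes w: "\<And>j. moment_weight x0 x1 (\<lambda>x. mat (w j x) :: complex^1^1)"
    and p: "\<And>j. orthogonal_polys x0 x1 (\<lambda>x. mat (w j x) :: complex^1^1) (\<lambda>n. mat (p j n))"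
  shows "orthogonal_polys x0 x1 (\<lambda>x. diag_sum (\<lambda>j. w j x)) (\<lambda>n. diag_sum (\<lambda>j. p j n))"
  unfolding orthogonal_polys_def
proof (intro conjI allI impI)
  interpret D: moment_weight x0 x1 "\<lambda>x. diag_sum (\<lambda>j. w j x)"
    by (rule moment_weight_diag_sum[OF w])
  fix n
  have deg: "coeff (p j n) n \<noteq> 0" "k > n \<Longrightarrow> coeff (p j n) k = 0" for j k
    using p[of j] by (auto simp: orthogonal_polys_def has_degree_def vec_eq_iff)
  then show "has_degree (diag_sum (\<lambda>j. p j n)) n"
    by (auto simp: has_degree_def vec_eq_iff)
  have "diag_sum (\<lambda>j. 1) = (mat 1 :: complex^'n^'n)"
    by (simp add: vec_eq_iff mat_def)
  then show "invertible (mat_coeff (diag_sum (\<lambda>j. p j n)) n)"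
    using deg(1) unfolding invertible_def
    by (intro exI[of _ "diag_sum (\<lambda>j. 1 / coeff (p j n) n)"])
       (simp add: mat_coeff_diag_sum diag_sum_mult)
  fix m assume "n \<noteq> m"
  have "D.ip (diag_sum (\<lambda>j. p j n)) (diag_sum (\<lambda>j. p j m)) $ i $ j = 0" for i j
  proof (cases "i = j")
    case True
    interpret S: moment_weight x0 x1 "\<lambda>x. mat (w i x) :: complex^1^1" by (rule w)
    have "S.ip (mat (p i n)) (mat (p i m)) $ 1 $ 1 = 0"
      using p[of i] \<open>n \<noteq> m\<close> by (simp add: orthogonal_polys_def)
    then have "set_lebesgue_integral lborel (einterval x0 x1)
        (\<lambda>x. poly (p i n) (complex_of_real x) * w i x * cnj (poly (p i m) (complex_of_real x))) = 0"
      by (simp add: S.ip_nth mult_nth)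
    with True show ?thesis
      by (simp add: D.ip_nth mat_eval_diag_sum adj_diag_sum diag_sum_mult)
  next
    case False
    then show ?thesis
      by (simp add: D.ip_nth mat_eval_diag_sum adj_diag_sum diag_sum_mult)
  qed
  then show "inner_W x0 x1 (\<lambda>x. diag_sum (\<lambda>j. w j x)) (diag_sum (\<lambda>j. p j n)) (diag_sum (\<lambda>j. p j m)) = 0"
    by (simp add: vec_eq_iff)
qed

text \<open>A unit column on the right selects column \<open>j\<close>; as the direct sum is
  diagonal, only \<open>q j\<close> survives. This extracts a vector operator from a square
  one.\<close>

lemma const_mat_column:
  "const_mat B ** diag_sum q ** const_mat (columnvector (axis j 1)) =
    const_mat (columnvector (column j B) :: complex^1^'m) ** mat (q j)"
proof -
  have "(const_mat B ** diag_sum q) $ a $ k = [:B $ a $ k:] * q k" for a k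
  proof -
    have "(const_mat B ** diag_sum q) $ a $ k = (\<Sum>l\<in>UNIV. if l = k then [:B $ a $ k:] * q k else 0)"
      unfolding mult_nth by (rule sum.cong) auto
    then show ?thesis by simp
  qed
  then have "(const_mat B ** diag_sum q ** const_mat (columnvector (axis j 1) :: complex^1^_)) $ a $ b =
      (\<Sum>k\<in>UNIV. if k = j then [:B $ a $ j:] * q j else 0)" for a b
    unfolding mult_nth[of "const_mat B ** diag_sum q"]
    by (intro sum.cong) (auto simp: columnvector_def axis_def)
  then have "(const_mat B ** diag_sum q ** const_mat (columnvector (axis j 1) :: complex^1^_)) $ a $ b =
      [:B $ a $ j:] * q j" for a b
    by simp
  moreover have "(const_mat (columnvector (column j B) :: complex^1^'m) ** mat (q j)) $ a $ b =
      [:B $ a $ j:] * q j" for a b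
    by (simp add: mult_nth columnvector_def column_def)
  ultimately show ?thesis by (simp only: vec_eq_iff simp_thms)
qed

text \<open>Inverse of the extraction: unit rows put the vectors side by side.\<close>

lemma const_mat_of_columns:
  "(\<Sum>j\<in>UNIV. const_mat (columnvector (v j) :: complex^1^'n) ** mat (q j) ** const_mat (rowvector (axis j 1))) =
    const_mat (\<chi> a j. v j $ a) ** diag_sum q"
proof -
  have "(const_mat (columnvector (v j) :: complex^1^'n) ** mat (q j) ** const_mat (rowvector (axis j 1))) $ a $ b =
      (if j = b then [:v j $ a:] * q j else 0)" for j a b
    by (simp add: mult_nth columnvector_def rowvector_def axis_def)
  moreover have "(const_mat (\<chi> a j. v j $ a) ** diag_sum q) $ a $ b =
      (\<Sum>j\<in>UNIV. if j = b then [:v j $ a:] * q j else 0)" for a b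
    unfolding mult_nth by (rule sum.cong) auto
  ultimately show ?thesis by (simp add: vec_eq_iff)
qed

section \<open>Darboux transformations and vector-valued operators\<close>

theorem theorem4p1:
  fixes x0 x1 :: ereal
    and W :: "real \<Rightarrow> complex^'n^'n"
    and P :: "nat \<Rightarrow> complex poly^'n^'n"
    and w :: "'n \<Rightarrow> real \<Rightarrow> complex"
    and p :: "'n \<Rightarrow> nat \<Rightarrow> complex poly"
  assumes "x0 < x1"
    and "weight_matrix x0 x1 W"
    and "orthogonal_polys x0 x1 W P"
    and "\<And>j. weight_matrix x0 x1 (\<lambda>x. mat (w j x) :: complex^1^1)"
    and "\<And>j. orthogonal_polys x0 x1 (\<lambda>x. mat (w j x) :: complex^1^1) (\<lambda>n. mat (p j n))"
    and "good_enough x0 x1 W"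
    and "\<And>j. good_enough x0 x1 (\<lambda>x. mat (w j x) :: complex^1^1)"
    and "good_enough x0 x1 (\<lambda>x. diag_sum (\<lambda>j. w j x))"
    and "good_enough x0 x1 (\<lambda>x. direct_sum (W x) (diag_sum (\<lambda>j. w j x)))"
  shows "darboux_transformation x0 x1 (\<lambda>x. diag_sum (\<lambda>j. w j x)) (\<lambda>n. diag_sum (\<lambda>j. p j n)) P \<longleftrightarrow>
    (\<exists>(D :: 'n \<Rightarrow> ('n, 1) dop) (\<Lambda> :: 'n \<Rightarrow> nat \<Rightarrow> complex^'n).
       (\<forall>j n. act (P n) (D j) = const_mat (columnvector (\<Lambda> j n)) ** mat (p j n)) \<and>
       (\<exists>n. inj (\<lambda>j. \<Lambda> j n) \<and> vec.independent (range (\<lambda>j. \<Lambda> j n))))"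
    (is "?darboux \<longleftrightarrow> ?vector_operators")
proof -
  define Q where "Q n = diag_sum (\<lambda>j. p j n)" for n
  define w' where "w' x = diag_sum (\<lambda>j. w j x)" for x
  have W: "moment_weight x0 x1 W" and w: "moment_weight x0 x1 w'"
    using assms(1,2,4) unfolding w'_def by (auto intro!: moment_weight_diag_sum moment_weightI)
  note P = assms(3)
  have Q: "orthogonal_polys x0 x1 w' Q"
    using orthogonal_polys_diag_sum[OF moment_weightI[OF assms(1,4)] assms(5)]
    by (simp add: Q_def[abs_def] w'_def[abs_def])
  note lead = orthogonal_polys_lead[OF P] orthogonal_polys_lead[OF Q]
  show ?thesis
  proof
    assume ?darboux
    then obtain V where V: "degree_preserving V" "\<forall>n. \<exists>A. act (Q n) V = const_mat A ** P n"
      unfolding darboux_transformation_def Q_def by blast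
    from V(2) obtain A where A: "\<And>n. act (Q n) V = const_mat (A n) ** P n" by metis
    interpret V: diagonal_action Q P V A
      by standard (use lead A in auto)
    \<comment> \<open>One index from the eventual range suffices, since independence is claimed for
      some \<open>n\<close> only.\<close>
    obtain n where n: "invertible (A n)"
      using V.eventually_invertible_if_degree_preserving[OF V(1)]
      by (meson eventually_sequentially order_refl)
    obtain N B where N: "\<And>n. act (P n) N = const_mat (B n) ** Q n"
      and B: "\<And>n. invertible (A n) \<Longrightarrow> invertible (B n)"
      using adjoint_operator[OF w W Q P A] by blast
    \<comment> \<open>Composing with a constant unit column takes column \<open>j\<close> of the
      adjoint \<open>N\<close>.\<close>
    define D :: "'n \<Rightarrow> ('n, 1) dop" where "D j = dop_mult N (monom (const_mat (columnvector (axis j 1))) 0)" for j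
    define \<Lambda> where "\<Lambda> j n = column j (B n)" for j n
    have "act (P n) (D j) = const_mat (columnvector (\<Lambda> j n)) ** mat (p j n)" for j n
      by (simp add: D_def \<Lambda>_def act_dop_mult N act_monom_0 Q_def const_mat_column)
    moreover have "inj (\<lambda>j. \<Lambda> j n) \<and> vec.independent (range (\<lambda>j. \<Lambda> j n))"
      unfolding independent_iff_invertible using B[OF n] by (simp add: \<Lambda>_def column_def)
    ultimately show ?vector_operators by blast
  next
    assume ?vector_operators
    then obtain D :: "'n \<Rightarrow> ('n, 1) dop" and \<Lambda> n\<^sub>0 where
      D: "\<And>j n. act (P n) (D j) = const_mat (columnvector (\<Lambda> j n)) ** mat (p j n)"
      and \<Lambda>: "inj (\<lambda>j. \<Lambda> j n\<^sub>0) \<and> vec.independent (range (\<lambda>j. \<Lambda> j n\<^sub>0))"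
      by blast
    define N where "N = (\<Sum>j\<in>UNIV. dop_mult (D j) (monom (const_mat (rowvector (axis j 1))) 0))"
    define L where "L n = (\<chi> a j. \<Lambda> j n $ a)" for n
    have N: "act (P n) N = const_mat (L n) ** Q n" for n
      by (simp add: N_def L_def act_sum act_dop_mult D act_monom_0 Q_def const_mat_of_columns)
    interpret N: diagonal_action P Q N L
      by standard (use lead N in auto)
    have "invertible (L n\<^sub>0)" using \<Lambda> unfolding independent_iff_invertible L_def .
    then have L: "\<forall>\<^sub>F n in sequentially. invertible (L n)" by (rule N.eventually_invertible)
    obtain V A where V: "\<And>n. act (Q n) V = const_mat (A n) ** P n"
      and A: "\<And>n. invertible (L n) \<Longrightarrow> invertible (A n)"
      using adjoint_operator[OF W w P Q N] by blast
    interpret V: diagonal_action Q P V A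
      by standard (use lead V in auto)
    \<comment> \<open>The two intertwining relations compose to an eigenvalue relation for
      \<open>Q\<close>, which places the product in the algebra of the direct sum weight.\<close>
    have "act (Q n) (dop_mult V N) = const_mat (A n ** L n) ** Q n" for n
      by (simp add: act_dop_mult V act_const_mult N const_mat_mult matrix_mul_assoc)
    then have "dop_mult V N \<in> D_alg x0 x1 w'"
      unfolding D_alg_def using Q by blast
    moreover have "degree_preserving N" using L by (rule N.degree_preserving)
    moreover have "degree_preserving V"
      using L A by (intro V.degree_preserving) (auto elim: eventually_mono)
    ultimately show ?darboux
      unfolding darboux_transformation_def using V by (fold Q_def w'_def) blast
  qed
qed

end
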